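(* Let $R$ be a commutative ring with unit and $X$ a set. Let $G\subseteq R\langle X\rangle$ be a set of polynomials and let $\operatorname{DM}:G\to\mathscr P(\langle X\rangle)$ be a function with $\operatorname{DM}(g)\subseteq\operatorname{supp}(g)$ for every $g\in G$. Let $f\in R\langle X\rangle$ be a polynomial such that $f\overset{*}{\to}_{G,\operatorname{DM}}0$. Then, for every labelled quiver $Q$ with labels in $X$ such that $\operatorname{DM}$ is compatible with $Q$, we have \[ f\text{ is compatible with }Q \iff f\text{ is a }Q\text{-consequence of }G. \]
   Context: $R\langle X\rangle$ is the free associative $R$-algebra on $X$ (coefficients commute with indeterminates); $\langle X\rangle$ is the set of monomials, i.e. words over $X$ including the empty word $1$; $\mathscr P(\langle X\rangle)$ is its power set; $\operatorname{supp}(f)$ is the set of monomials with nonzero coefficient in $f$. A labelled quiver with labels in $X$ is $Q=(V,E,X,s,t,l)$ with $V$ a set of vertices, $E$ a set of edges, source and target maps $s,t:E\to V$ and a label function $l:E\to X$ (not necessarily injective). A nonempty path is $p=e_n\cdots e_1$ with $s(e_{i+1})=t(e_i)$; $s(p)=s(e_1)$, $t(p)=t(e_n)$, $l(p)=l(e_n)\cdots l(e_1)\in\langle X\rangle$. For each vertex $v$ there is an empty path $\epsilon_v$ from $v$ to $v$ with $l(\epsilon_v)=1$. Signatures: for a monomial $m$, $\sigma(m)=\{(s(p),t(p)) \mid p \text{ a path in } Q \text{ with } l(p)=m\}\subseteq V\times V$; for a polynomial $f$, $\sigma(f)=\bigcap_{m\in\operatorname{supp}(f)}\sigma(m)$ (so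 $\sigma(0)=V\times V$). $f$ is compatible with $Q$ if $\sigma(f)\neq\emptyset$. A $Q$-consequence of $F\subseteq R\langle X\rangle$ is a polynomial $f\in R\langle X\rangle$, compatible with $Q$, such that there exist finitely many $g_i\in F$, $a_i,b_i\in R\langle X\rangle$, $1\le i\le n$, with $f=\sum_{i=1}^n a_ig_ib_i$ (the empty sum being $0$) and such that for every $(u,v)\in\sigma(f)$ and every $i$ there exist vertices $u_i,v_i$ with $(u,u_i)\in\sigma(b_i)$, $(u_i,v_i)\in\sigma(g_i)$ and $(v_i,v)\in\sigma(a_i)$. Rewriting: let $g\in R\langle X\rangle$ and $m\in\operatorname{supp}(g)$. If some monomial in $\operatorname{supp}(f)$ has the form $amb$ with monomials $a,b\in\langle X\rangle$, then for every $\lambda\in R$ we say that $f$ can be rewritten to $h:=f+\lambda agb$ using $(g,m)$. We write $f\to_{G,\operatorname{DM}}h$ if there are $g\in G$ and $m\in\operatorname{DM}(g)$ such that $f$ can be rewritten to $h$ using $(g,m)$; $\overset{*}{\to}_{G,\operatorname{DM}}$ is the reflexive transitive closure of $\to_{G,\operatorname{DM}}$. $\operatorname{DM}$ is compatible with $Q$ if $\sigma(m)=\sigma(g)$ for every $g\in G$ and every $m\in\operatorname{DM}(g)$. *)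

theory Defs
  imports "HOL-Library.Poly_Mapping" "Graph_Theory.Arc_Walk"
begin

text \<open>
  Words under concatenation form an additively written monoid, so that \<open>'x list \<Rightarrow>\<^sub>0 'r\<close> with the
  convolution product is the free associative \<open>'r\<close>-algebra on \<open>'x\<close>: the coefficient of \<open>w\<close>
  in \<open>p * q\<close> is the sum of all products of coefficients of \<open>u\<close> in \<open>p\<close> and \<open>v\<close> in \<open>q\<close> with
  \<open>u @ v = w\<close>. Coefficients have sort
  \<open>{comm_ring, comm_monoid_mult}\<close> rather than \<^class>\<open>comm_ring_1\<close> because the latter excludes
  the zero ring.
\<close>

instantiation list :: (type) monoid_add
begin

definition zero_list :: "'a list" where
  "zero_list = []"

definition plus_list :: "'a list \<Rightarrow> 'a list \<Rightarrow> 'a list" where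
  "plus_list = (@)"

instance
  by standard (simp_all add: zero_list_def plus_list_def)

end

type_synonym ('x, 'r) ncpoly = "'x list \<Rightarrow>\<^sub>0 'r"

abbreviation supp :: "('x, 'r::zero) ncpoly \<Rightarrow> 'x list set" where
  "supp \<equiv> Poly_Mapping.keys"

text \<open>
  The set of indeterminates is an explicit subset \<open>X\<close> of the type \<open>'x\<close>, since it may be empty.
\<close>

definition free_alg :: "'x set \<Rightarrow> ('x, 'r::{comm_ring, comm_monoid_mult}) ncpoly set" where
  "free_alg X = {f. supp f \<subseteq> lists X}"

definition monomial :: "'x list \<Rightarrow> ('x, 'r::{comm_ring, comm_monoid_mult}) ncpoly" where
  "monomial w = Poly_Mapping.single w 1"

definition const_poly :: "'r \<Rightarrow> ('x, 'r::{comm_ring, comm_monoid_mult}) ncpoly" where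
  "const_poly c = Poly_Mapping.single [] c"

locale labelled_quiver = wf_digraph Q
  for X :: "'x set" and Q :: "('v, 'e) pre_digraph" and l :: "'e \<Rightarrow> 'x" +
  assumes label_in: "e \<in> arcs Q \<Longrightarrow> l e \<in> X"

text \<open>
  A walk lists its arcs in order of traversal, so the path \<open>e\<^sub>n \<dots> e\<^sub>1\<close> is the
  walk \<open>[e\<^sub>1, \<dots>, e\<^sub>n]\<close> and its label is read off in reverse. The empty walk from \<open>u\<close> to \<open>v\<close>
  exists only for a vertex \<open>u = v\<close>.
\<close>

definition path_label :: "('e \<Rightarrow> 'x) \<Rightarrow> 'e list \<Rightarrow> 'x list" where
  "path_label l p = rev (map l p)"

definition sig_mon ::
  "('v, 'e) pre_digraph \<Rightarrow> ('e \<Rightarrow> 'x) \<Rightarrow> 'x list \<Rightarrow> ('v \<times> 'v) set" where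
  "sig_mon Q l m = {(u, v). \<exists>p. pre_digraph.awalk Q u p v \<and> path_label l p = m}"

text \<open>The intersection is taken inside \<open>verts Q \<times> verts Q\<close>, which is thus the signature of 0.\<close>

definition sig_poly ::
  "('v, 'e) pre_digraph \<Rightarrow> ('e \<Rightarrow> 'x) \<Rightarrow> ('x, 'r::{comm_ring, comm_monoid_mult}) ncpoly
    \<Rightarrow> ('v \<times> 'v) set" where
  "sig_poly Q l f = (verts Q \<times> verts Q) \<inter> (\<Inter>m\<in>supp f. sig_mon Q l m)"

definition compatible ::
  "('v, 'e) pre_digraph \<Rightarrow> ('e \<Rightarrow> 'x) \<Rightarrow> ('x, 'r::{comm_ring, comm_monoid_mult}) ncpoly
    \<Rightarrow> bool" where
  "compatible Q l f \<longleftrightarrow> sig_poly Q l f \<noteq> {}"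

definition Q_consequence ::
  "'x set \<Rightarrow> ('v, 'e) pre_digraph \<Rightarrow> ('e \<Rightarrow> 'x) \<Rightarrow>
    ('x, 'r::{comm_ring, comm_monoid_mult}) ncpoly set \<Rightarrow> ('x, 'r) ncpoly \<Rightarrow> bool" where
  "Q_consequence X Q l F f \<longleftrightarrow>
    f \<in> free_alg X \<and> compatible Q l f \<and>
    (\<exists>(n::nat) g a b.
      (\<forall>i<n. g i \<in> F \<and> a i \<in> free_alg X \<and> b i \<in> free_alg X) \<and>
      f = (\<Sum>i<n. a i * g i * b i) \<and>
      (\<forall>(u, v) \<in> sig_poly Q l f. \<forall>i<n. \<exists>u' \<in> verts Q. \<exists>v' \<in> verts Q.
        (u, u') \<in> sig_poly Q l (b i) \<and> (u', v') \<in> sig_poly Q l (g i) \<and>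
        (v', v) \<in> sig_poly Q l (a i)))"

definition rewrite_using ::
  "'x set \<Rightarrow> ('x, 'r::{comm_ring, comm_monoid_mult}) ncpoly \<Rightarrow> 'x list
    \<Rightarrow> ('x, 'r) ncpoly \<Rightarrow> ('x, 'r) ncpoly \<Rightarrow> bool" where
  "rewrite_using X g m f h \<longleftrightarrow>
    m \<in> supp g \<and>
    (\<exists>a \<in> lists X. \<exists>b \<in> lists X. \<exists>c. a @ m @ b \<in> supp f \<and>
      h = f + const_poly c * (monomial a * g * monomial b))"

definition rewrite_step ::
  "'x set \<Rightarrow> ('x, 'r::{comm_ring, comm_monoid_mult}) ncpoly set
    \<Rightarrow> (('x, 'r) ncpoly \<Rightarrow> 'x list set) \<Rightarrow> ('x, 'r) ncpoly \<Rightarrow> ('x, 'r) ncpoly \<Rightarrow> bool" where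
  "rewrite_step X G DM f h \<longleftrightarrow> (\<exists>g \<in> G. \<exists>m \<in> DM g. rewrite_using X g m f h)"

definition DM_compatible ::
  "('v, 'e) pre_digraph \<Rightarrow> ('e \<Rightarrow> 'x) \<Rightarrow> ('x, 'r::{comm_ring, comm_monoid_mult}) ncpoly set
    \<Rightarrow> (('x, 'r) ncpoly \<Rightarrow> 'x list set) \<Rightarrow> bool" where
  "DM_compatible Q l G DM \<longleftrightarrow> (\<forall>g \<in> G. \<forall>m \<in> DM g. sig_mon Q l m = sig_poly Q l g)"

end

theory Submission
  imports Defs
begin

text \<open>
  A rewriting step uses a monomial \<open>a m b\<close> in the support of \<open>f\<close> with \<open>\<sigma>(m) = \<sigma>(g)\<close>. Hence a path
  with label \<open>a m b\<close> between \<open>u\<close> and \<open>v\<close> splits at two vertices between which \<open>g\<close> lies in the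
  signature, so all monomials of \<open>a g b\<close> admit a path from \<open>u\<close> to \<open>v\<close>. A step therefore never shrinks
  the signature, and the summand it contributes is admissible at every pair in \<open>\<sigma>(f)\<close>. For the
  induction along the reduction the set of pairs is kept fixed at \<open>S = \<sigma>(f)\<close> while the
  signature of the current polynomial may grow.
\<close>

text \<open>This is the existential clause of \<open>Q_consequence\<close> with the pairs ranging
  over a free parameter \<open>S\<close>, so that the pairs no longer change with the polynomial
  under consideration.\<close>

definition rep_on ::
  "'x set \<Rightarrow> ('v, 'e) pre_digraph \<Rightarrow> ('e \<Rightarrow> 'x) \<Rightarrow>
    ('x, 'r::{comm_ring, comm_monoid_mult}) ncpoly set \<Rightarrow> ('v \<times> 'v) set \<Rightarrow>
    ('x, 'r) ncpoly \<Rightarrow> bool" where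
  "rep_on X Q l F S f \<longleftrightarrow>
    (\<exists>(n::nat) g a b.
      (\<forall>i<n. g i \<in> F \<and> a i \<in> free_alg X \<and> b i \<in> free_alg X) \<and>
      f = (\<Sum>i<n. a i * g i * b i) \<and>
      (\<forall>(u, v) \<in> S. \<forall>i<n. \<exists>u' \<in> verts Q. \<exists>v' \<in> verts Q.
        (u, u') \<in> sig_poly Q l (b i) \<and> (u', v') \<in> sig_poly Q l (g i) \<and>
        (v', v) \<in> sig_poly Q l (a i)))"

lemma rep_on_0: "rep_on X Q l F S 0"
  unfolding rep_on_def by (rule exI[of _ 0]) simp

lemma rep_on_add:
  assumes "rep_on X Q l F S h" and "g \<in> F" and "a \<in> free_alg X" and "b \<in> free_alg X"
    and "\<And>u v. (u, v) \<in> S \<Longrightarrow> \<exists>u' \<in> verts Q. \<exists>v' \<in> verts Q.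
      (u, u') \<in> sig_poly Q l b \<and> (u', v') \<in> sig_poly Q l g \<and> (v', v) \<in> sig_poly Q l a"
  shows "rep_on X Q l F S (h + a * g * b)"
proof -
  obtain n :: nat and gs as bs where
    mem: "\<forall>i<n. gs i \<in> F \<and> as i \<in> free_alg X \<and> bs i \<in> free_alg X" and
    h: "h = (\<Sum>i<n. as i * gs i * bs i)" and
    sig: "\<forall>(u, v) \<in> S. \<forall>i<n. \<exists>u' \<in> verts Q. \<exists>v' \<in> verts Q.
      (u, u') \<in> sig_poly Q l (bs i) \<and> (u', v') \<in> sig_poly Q l (gs i) \<and>
      (v', v) \<in> sig_poly Q l (as i)"
    using assms(1) unfolding rep_on_def by blast
  have "\<forall>(u, v) \<in> S. \<forall>i<Suc n. \<exists>u' \<in> verts Q. \<exists>v' \<in> verts Q.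
      (u, u') \<in> sig_poly Q l ((bs(n := b)) i) \<and> (u', v') \<in> sig_poly Q l ((gs(n := g)) i) \<and>
      (v', v) \<in> sig_poly Q l ((as(n := a)) i)"
    using sig assms(5) by (auto simp: less_Suc_eq)
  moreover have "\<forall>i<Suc n. (gs(n := g)) i \<in> F \<and> (as(n := a)) i \<in> free_alg X \<and>
      (bs(n := b)) i \<in> free_alg X"
    using mem assms(2-4) by (simp add: less_Suc_eq)
  moreover have "h + a * g * b =
      (\<Sum>i<Suc n. (as(n := a)) i * (gs(n := g)) i * (bs(n := b)) i)"
    by (simp add: h)
  ultimately show ?thesis
    unfolding rep_on_def by blast
qed

text \<open>Absorbing the scalar into the left cofactor gives the summand of a rewriting step the
  shape \<open>a * g * b\<close> that \<open>rep_on\<close> asks for.\<close>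

lemma const_poly_mult_monomials:
  "const_poly c * (monomial a * g * monomial b) =
    Poly_Mapping.single a c * g * Poly_Mapping.single b 1"
proof -
  have "const_poly c * (monomial a * g * monomial b) =
      const_poly c * monomial a * g * monomial b"
    by (simp only: mult.assoc)
  also have "const_poly c * monomial a = Poly_Mapping.single a c"
    by (simp add: const_poly_def monomial_def mult_single plus_list_def)
  finally show ?thesis
    by (simp only: monomial_def)
qed

text \<open>Only an inclusion: \<open>c\<close> and \<open>d\<close> may be zero or annihilate
  coefficients of \<open>g\<close>.\<close>

lemma supp_single_mult_single:
  "supp (Poly_Mapping.single a c * g * Poly_Mapping.single b d) \<subseteq> {a @ w @ b | w. w \<in> supp g}"
  (is "supp (?a * g * ?b) \<subseteq> _")
proof
  fix w
  assume "w \<in> supp (?a * g * ?b)"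
  then obtain p q where "w = p + q" "p \<in> supp (?a * g)" "q \<in> supp ?b"
    using keys_mult[of "?a * g" ?b] by blast
  moreover from this obtain r s where "p = r + s" "r \<in> supp ?a" "s \<in> supp g"
    using keys_mult[of ?a g] by blast
  ultimately show "w \<in> {a @ w @ b | w. w \<in> supp g}"
    by (auto simp: plus_list_def split: if_splits)
qed

context labelled_quiver
begin

lemma sig_mon_verts: "(u, v) \<in> sig_mon Q l m \<Longrightarrow> u \<in> verts Q \<and> v \<in> verts Q"
  unfolding sig_mon_def by (auto dest: awalk_hd_in_verts awalk_last_in_verts)

text \<open>Labels are read against the direction of travel, so a path labelled \<open>a @ b\<close>
  first runs through \<open>b\<close>. Cutting it there makes the signature of a product a
  composition of relations.\<close>

lemma sig_mon_append:
  "(u, v) \<in> sig_mon Q l (a @ b) \<longleftrightarrow> (\<exists>w. (u, w) \<in> sig_mon Q l b \<and> (w, v) \<in> sig_mon Q l a)"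
proof
  assume "(u, v) \<in> sig_mon Q l (a @ b)"
  then obtain p where p: "awalk u p v" "rev (map l p) = a @ b"
    unfolding sig_mon_def path_label_def by blast
  then have "map l p = rev b @ rev a"
    by (metis rev_append rev_rev_ident)
  then obtain q r where qr: "p = q @ r" "map l q = rev b" "map l r = rev a"
    by (auto simp: map_eq_append_conv)
  with p(1) have "awalk u q (awlast u q)" "awalk (awlast u q) r v"
    by simp_all
  moreover have "path_label l q = b" "path_label l r = a"
    using qr by (simp_all add: path_label_def)
  ultimately have "(u, awlast u q) \<in> sig_mon Q l b" "(awlast u q, v) \<in> sig_mon Q l a"
    unfolding sig_mon_def by auto
  then show "\<exists>w. (u, w) \<in> sig_mon Q l b \<and> (w, v) \<in> sig_mon Q l a"
    by blast
next
  assume "\<exists>w. (u, w) \<in> sig_mon Q l b \<and> (w, v) \<in> sig_mon Q l a"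
  then obtain w q r where "awalk u q w" "awalk w r v" "rev (map l q) = b" "rev (map l r) = a"
    unfolding sig_mon_def path_label_def by blast
  then show "(u, v) \<in> sig_mon Q l (a @ b)"
    unfolding sig_mon_def path_label_def by (auto intro!: exI[of _ "q @ r"])
qed

text \<open>Equality can fail for \<open>c = 0\<close>, where the right side is all of
  \<open>verts Q \<times> verts Q\<close>. The inclusion is the direction in which paths make
  cofactors admissible.\<close>

lemma sig_mon_subset_sig_single:
  "sig_mon Q l w \<subseteq> sig_poly Q l (Poly_Mapping.single w c)"
  unfolding sig_poly_def using sig_mon_verts by (auto split: if_splits)

lemma sig_poly_rewrite:
  assumes "DM_compatible Q l G DM" and "g \<in> G" and "m \<in> DM g" and "a @ m @ b \<in> supp f"
    and "(u, v) \<in> sig_poly Q l f"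
  obtains u' v' where "(u, u') \<in> sig_mon Q l b" "(u', v') \<in> sig_poly Q l g"
    "(v', v) \<in> sig_mon Q l a"
proof -
  have "(u, v) \<in> sig_mon Q l (a @ m @ b)"
    using assms(4,5) unfolding sig_poly_def by blast
  moreover have "sig_mon Q l m = sig_poly Q l g"
    using assms(1-3) unfolding DM_compatible_def by blast
  ultimately show ?thesis
    using that by (auto simp: sig_mon_append)
qed

lemma sig_poly_rewrite_mono:
  assumes "DM_compatible Q l G DM" and "rewrite_step X G DM f h"
  shows "sig_poly Q l f \<subseteq> sig_poly Q l h"
proof (rule subrelI)
  fix u v
  assume uv: "(u, v) \<in> sig_poly Q l f"
  from assms(2) obtain g m a b c where g: "g \<in> G" "m \<in> DM g" "a @ m @ b \<in> supp f"
    and h: "h = f + const_poly c * (monomial a * g * monomial b)"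
    unfolding rewrite_step_def rewrite_using_def by blast
  obtain u' v' where path: "(u, u') \<in> sig_mon Q l b" "(u', v') \<in> sig_poly Q l g"
    "(v', v) \<in> sig_mon Q l a"
    using sig_poly_rewrite[OF assms(1) g uv] .
  have h': "h = f + Poly_Mapping.single a c * g * Poly_Mapping.single b 1"
    by (simp add: h const_poly_mult_monomials)
  \<comment> \<open>Cancellation, even of \<open>a @ m @ b\<close> itself, only removes conditions.
    A monomial of \<open>h\<close> that is new comes from some monomial of \<open>g\<close> placed
    between \<open>a\<close> and \<open>b\<close>.\<close>
  have "(u, v) \<in> sig_mon Q l w" if "w \<in> supp h" for w
  proof (cases "w \<in> supp f")
    case True
    then show ?thesis
      using uv unfolding sig_poly_def by blast
  next
    case False
    with that have "w \<in> supp (Poly_Mapping.single a c * g * Poly_Mapping.single b 1)"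
      unfolding h' by (meson Poly_Mapping.keys_add UnE subsetD)
    then obtain w' where "w = a @ w' @ b" "w' \<in> supp g"
      using supp_single_mult_single by blast
    with path show ?thesis
      unfolding sig_poly_def by (auto simp: sig_mon_append)
  qed
  with uv show "(u, v) \<in> sig_poly Q l h"
    unfolding sig_poly_def by blast
qed

lemma rep_on_rewrite_step:
  assumes "DM_compatible Q l G DM" and "rewrite_step X G DM f h"
    and "S \<subseteq> sig_poly Q l f" and "rep_on X Q l G S h"
  shows "rep_on X Q l G S f"
proof -
  from assms(2) obtain g m a b c where g: "g \<in> G" "m \<in> DM g" "a @ m @ b \<in> supp f"
    and ab: "a \<in> lists X" "b \<in> lists X"
    and h: "h = f + const_poly c * (monomial a * g * monomial b)"
    unfolding rewrite_step_def rewrite_using_def by blast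
  \<comment> \<open>The step is undone by subtracting its summand; the sign goes into the left
    cofactor.\<close>
  let ?a = "Poly_Mapping.single a (- c)" and ?b = "Poly_Mapping.single b 1"
  have "f = h + ?a * g * ?b"
    by (simp add: h const_poly_mult_monomials single_uminus)
  moreover have "rep_on X Q l G S (h + ?a * g * ?b)"
  proof (rule rep_on_add)
    show "?a \<in> free_alg X" "?b \<in> free_alg X"
      using ab by (auto simp: free_alg_def)
    fix u v
    assume "(u, v) \<in> S"
    then obtain u' v' where path: "(u, u') \<in> sig_mon Q l b" "(u', v') \<in> sig_poly Q l g"
      "(v', v) \<in> sig_mon Q l a"
      using sig_poly_rewrite[OF assms(1) g] assms(3) by blast
    have "u' \<in> verts Q" "v' \<in> verts Q"
      using path sig_mon_verts by simp_all
    moreover have "(u, u') \<in> sig_poly Q l ?b" "(v', v) \<in> sig_poly Q l ?a"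
      using path sig_mon_subset_sig_single by auto
    ultimately show "\<exists>u' \<in> verts Q. \<exists>v' \<in> verts Q. (u, u') \<in> sig_poly Q l ?b \<and>
        (u', v') \<in> sig_poly Q l g \<and> (v', v) \<in> sig_poly Q l ?a"
      using path(2) by auto
  qed (use assms(4) g in auto)
  ultimately show ?thesis
    by simp
qed

text \<open>Induction from the end of the reduction: 0 is the empty sum, and each step taken
  backwards adds one summand. The inclusion of \<open>S\<close> travels forwards, by monotonicity of
  signatures.\<close>

lemma rep_on_rewrites:
  assumes "(rewrite_step X G DM)\<^sup>*\<^sup>* f 0" and "DM_compatible Q l G DM"
    and "S \<subseteq> sig_poly Q l f"
  shows "rep_on X Q l G S f"
  using assms(1,3)
proof (induction rule: converse_rtranclp_induct)
  case base
  show ?case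
    by (rule rep_on_0)
next
  case (step f h)
  have "S \<subseteq> sig_poly Q l h"
    using sig_poly_rewrite_mono[OF assms(2) step.hyps(1)] step.prems by blast
  then show ?case
    using rep_on_rewrite_step[OF assms(2) step.hyps(1) step.prems step.IH] by blast
qed

end

theorem theorem3:
  fixes X :: "'x set"
    and G :: "('x, 'r::{comm_ring, comm_monoid_mult}) ncpoly set"
    and DM :: "('x, 'r) ncpoly \<Rightarrow> 'x list set"
    and f :: "('x, 'r) ncpoly"
    and Q :: "('v, 'e) pre_digraph"
    and l :: "'e \<Rightarrow> 'x"
  assumes "G \<subseteq> free_alg X"
    and "\<And>g. g \<in> G \<Longrightarrow> DM g \<subseteq> supp g"
    and "f \<in> free_alg X"
    and "(rewrite_step X G DM)\<^sup>*\<^sup>* f 0"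
    and "labelled_quiver X Q l"
    and "DM_compatible Q l G DM"
  shows "compatible Q l f \<longleftrightarrow> Q_consequence X Q l G f"
proof -
  interpret labelled_quiver X Q l
    by fact
  have "rep_on X Q l G (sig_poly Q l f) f"
    using rep_on_rewrites[OF assms(4,6) subset_refl] .
  \<comment> \<open>With \<open>S\<close> equal to the signature of \<open>f\<close>, the
    representation clause holds outright, so the two sides differ only by conditions already
    known.\<close>
  then show ?thesis
    using assms(3) unfolding Q_consequence_def rep_on_def by blast
qed

end
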